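(* Let $\mathcal{F},\mathcal{G}$ be regular thin families with $1\leq o(\mathcal{F})\leq o(\mathcal{G})$. Let $X$ be a Banach space and $(x_s)_{s\in\mathcal{F}}$ be an $\mathcal{F}$-sequence in $X$ which admits an $\mathcal{F}$-spreading model $(e_n)_n$. Then there exists a $\mathcal{G}$-sequence $(w_t)_{t\in\mathcal{G}}$ in $X$ with $\{w_t:t\in\mathcal{G}\}\subseteq\{x_s:s\in\mathcal{F}\}$ which admits $(e_n)_n$ as a $\mathcal{G}$-spreading model.
   Context: $\mathbb{N}=\{1,2,\dots\}$. For $M\subseteq\mathbb{N}$, $[M]^{<\infty}$ and $[M]^\infty$ denote the sets of finite, respectively infinite, subsets of $M$. For $s\subseteq\mathbb{N}$, $s(k)$ is the $k$-th element of $s$ in increasing order and $|s|$ its cardinality. $t\sqsubseteq s$ (resp. $t\sqsubset s$) means that $t$ is an initial (resp. proper initial) segment of $s$. For $\mathcal{F}\subseteq[\mathbb{N}]^{<\infty}$, $\mathcal{F}\upharpoonright M=\mathcal{F}\cap[M]^{<\infty}$ and $\widehat{\mathcal{F}}=\{t\in[\mathbb{N}]^{<\infty}:\exists s\in\mathcal{F},\ t\sqsubseteq s\}$. A nonempty family $\mathcal{R}\subseteq[\mathbb{N}]^{<\infty}$ is regular if it is hereditary (closed under subsets), spreading (if $\{n_1<\dots<n_k\}\in\mathcal{R}$, $m_1<\dots<m_k$ and $n_i\leq m_i$ for all $i$, then $\{m_1,\dots,m_k\}\in\mathcal{R}$) and compact (the set of characteristic functions of its members is closed in $\{0,1\}^{\mathbb{N}}$).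 $\mathcal{F}$ is thin if no element of $\mathcal{F}$ is a proper initial segment of another one. $\mathcal{F}$ is regular thin if it is thin and $\widehat{\mathcal{F}}$ is regular. The order $o(\mathcal{F})$ of a nonempty family: if $\widehat{\mathcal{F}}$ contains an infinite $\sqsubset$-increasing sequence, $o(\mathcal{F})=\omega_1$; otherwise put $o_{\widehat{\mathcal{F}}}(s)=0$ for $\sqsubseteq$-maximal $s\in\widehat{\mathcal{F}}$, recursively $o_{\widehat{\mathcal{F}}}(s)=\sup\{o_{\widehat{\mathcal{F}}}(t)+1:t\in\widehat{\mathcal{F}},\ s\sqsubset t\}$, and $o(\mathcal{F})=o_{\widehat{\mathcal{F}}}(\varnothing)$. A tuple $(s_j)_{j=1}^k$ of nonempty finite subsets of $\mathbb{N}$ is a plegma family if (i) $s_i(m)<s_j(m)$ whenever $i<j$ and $m\leq\min(|s_i|,|s_j|)$; and (ii) for all $i,j$, $s_i(m)<s_j(m+1)$ whenever $m\leq\min(|s_i|,|s_j|-1)$. $\mathrm{Plm}_k(\mathcal{F})$ is the set of all plegma families $(s_j)_{j=1}^k$ with all $s_j\in\mathcal{F}$. For a regular thin family $\mathcal{F}$, an $\mathcal{F}$-sequence in $X$ is a map $\mathcal{F}\to X$, written $(x_s)_{s\in\mathcal{F}}$. Let $(E,\|\cdot\|_* )$ be an infinite dimensional seminormed linear space with Hamel basis $(e_n)_n$, and $M\in[\mathbb{N}]^\infty$. The $\mathcal{F}$-subsequence $(x_s)_{s\in\mathcal{F}\upharpoonright M}$ generates $(e_n)_n$ as an $\mathcal{F}$-spreading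 model if there is a null sequence $(\delta_n)_n$ of positive reals such that for all $l\in\mathbb{N}$, $1\leq k\leq l$, $a_1,\dots,a_k\in[-1,1]$ and $(s_j)_{j=1}^k\in\mathrm{Plm}_k(\mathcal{F}\upharpoonright M)$ with $s_1(1)\geq M(l)$, $$\Big|\,\Big\|\sum_{j=1}^ka_jx_{s_j}\Big\|-\Big\|\sum_{j=1}^ka_je_j\Big\|_*\Big|\leq\delta_l.$$ $(x_s)_{s\in\mathcal{F}}$ admits $(e_n)_n$ as an $\mathcal{F}$-spreading model if $(x_s)_{s\in\mathcal{F}\upharpoonright M}$ generates $(e_n)_n$ for some $M\in[\mathbb{N}]^\infty$. *)

theory Defs
  imports "HOL-Analysis.Analysis" "HOL-Library.Infinite_Set"
begin

section \<open>Ordinals\<close>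

text \<open>
  Well-orders on subsets of \<^typ>\<open>nat set\<close> up to isomorphism: the ordinals of cardinality at
  most that of the continuum. They include \<open>\<omega>\<^sub>1\<close>, hence all values of the order of a family of
  finite sets of naturals.
\<close>

quotient_type ordinal = "nat set rel" / partial: "\<lambda>r r'. (r, r') \<in> ordIso"
proof (rule part_equivpI)
  show "\<exists>x::nat set rel. (x, x) \<in> ordIso"
    using ordIso_reflexive[OF card_of_Well_order] by blast
  show "symp (\<lambda>r r'::nat set rel. (r, r') \<in> ordIso)"
    by (auto intro: sympI ordIso_symmetric)
  show "transp (\<lambda>r r'::nat set rel. (r, r') \<in> ordIso)"
    by (rule transpI, rule ordIso_transitive)
qed

lift_definition omega1 :: ordinal is "cardSuc natLeq"
  by (simp add: cardSuc_Card_order natLeq_Card_order ordIso_refl)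

instantiation ordinal :: linorder
begin

lift_definition less_eq_ordinal :: "ordinal \<Rightarrow> ordinal \<Rightarrow> bool" is "\<lambda>r r'. (r, r') \<in> ordLeq"
proof -
  fix r r' q q' :: "nat set rel"
  assume r: "(r, r') \<in> ordIso" and q: "(q, q') \<in> ordIso"
  show "((r, q) \<in> ordLeq) = ((r', q') \<in> ordLeq)"
  proof
    assume "(r, q) \<in> ordLeq"
    then show "(r', q') \<in> ordLeq"
      by (rule ordIso_ordLeq_trans[OF ordIso_symmetric[OF r] ordLeq_ordIso_trans[OF _ q]])
  next
    assume "(r', q') \<in> ordLeq"
    then show "(r, q) \<in> ordLeq"
      by (rule ordIso_ordLeq_trans[OF r ordLeq_ordIso_trans[OF _ ordIso_symmetric[OF q]]])
  qed
qed

lift_definition less_ordinal :: "ordinal \<Rightarrow> ordinal \<Rightarrow> bool" is "\<lambda>r r'. (r, r') \<in> ordLess"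
proof -
  fix r r' q q' :: "nat set rel"
  assume r: "(r, r') \<in> ordIso" and q: "(q, q') \<in> ordIso"
  show "((r, q) \<in> ordLess) = ((r', q') \<in> ordLess)"
  proof
    assume "(r, q) \<in> ordLess"
    then show "(r', q') \<in> ordLess"
      by (rule ordIso_ordLess_trans[OF ordIso_symmetric[OF r] ordLess_ordIso_trans[OF _ q]])
  next
    assume "(r', q') \<in> ordLess"
    then show "(r, q) \<in> ordLess"
      by (rule ordIso_ordLess_trans[OF r ordLess_ordIso_trans[OF _ ordIso_symmetric[OF q]]])
  qed
qed

instance
proof
  fix x y z :: ordinal
  have W: "Well_order r" if "(r, r) \<in> ordIso" for r :: "nat set rel"
    using that by (simp add: ordIso_def)
  show "(x < y) = (x \<le> y \<and> \<not> y \<le> x)"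
    by transfer (use W not_ordLeq_iff_ordLess ordLess_imp_ordLeq in blast)
  show "x \<le> x"
    by transfer (simp add: ordIso_imp_ordLeq)
  show "x \<le> y \<Longrightarrow> y \<le> z \<Longrightarrow> x \<le> z"
    by transfer (rule ordLeq_transitive)
  show "x \<le> y \<Longrightarrow> y \<le> x \<Longrightarrow> x = y"
    by transfer (simp add: ordIso_iff_ordLeq)
  show "x \<le> y \<or> y \<le> x"
    by transfer (simp add: W ordLeq_total)
qed

end

instance ordinal :: wellorder
proof
  fix P :: "ordinal \<Rightarrow> bool" and a :: ordinal
  assume step: "\<And>x. (\<And>y. y < x \<Longrightarrow> P y) \<Longrightarrow> P x"
  have "wf {(x, y::ordinal). x < y}"
  proof (rule wf_subset)
    show "wf (inv_image (ordLess :: (nat set rel \<times> nat set rel) set) rep_ordinal)"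
      by (rule wf_inv_image[OF wf_ordLess])
    show "{(x, y::ordinal). x < y} \<subseteq> inv_image ordLess rep_ordinal"
      by (auto simp: inv_image_def less_ordinal_def)
  qed
  then show "P a"
    by (induction a rule: wf_induct_rule) (auto intro: step)
qed

instantiation ordinal :: "{conditionally_complete_linorder, zero, one}"
begin

definition sup_ordinal :: "ordinal \<Rightarrow> ordinal \<Rightarrow> ordinal" where "sup_ordinal = max"
definition inf_ordinal :: "ordinal \<Rightarrow> ordinal \<Rightarrow> ordinal" where "inf_ordinal = min"
definition Sup_ordinal :: "ordinal set \<Rightarrow> ordinal" where "Sup_ordinal A = (LEAST b. \<forall>a\<in>A. a \<le> b)"
definition Inf_ordinal :: "ordinal set \<Rightarrow> ordinal" where "Inf_ordinal A = (LEAST a. a \<in> A)"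
definition zero_ordinal :: ordinal where "zero_ordinal = (LEAST a. True)"
definition one_ordinal :: ordinal where "one_ordinal = (LEAST a. 0 < a)"

instance
proof
  fix x z :: ordinal and X :: "ordinal set"
  show "x \<in> X \<Longrightarrow> bdd_below X \<Longrightarrow> Inf X \<le> x"
    by (simp add: Inf_ordinal_def Least_le)
  show "X \<noteq> {} \<Longrightarrow> (\<And>x. x \<in> X \<Longrightarrow> z \<le> x) \<Longrightarrow> z \<le> Inf X"
    by (metis Inf_ordinal_def LeastI_ex ex_in_conv)
  show "x \<in> X \<Longrightarrow> bdd_above X \<Longrightarrow> x \<le> Sup X"
  proof -
    assume "x \<in> X" "bdd_above X"
    then obtain u where "\<forall>a\<in>X. a \<le> u"
      by (auto simp: bdd_above_def)
    then have "\<forall>a\<in>X. a \<le> Sup X"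
      unfolding Sup_ordinal_def by (rule LeastI)
    with \<open>x \<in> X\<close> show ?thesis by blast
  qed
  show "X \<noteq> {} \<Longrightarrow> (\<And>x. x \<in> X \<Longrightarrow> x \<le> z) \<Longrightarrow> Sup X \<le> z"
    by (simp add: Sup_ordinal_def Least_le)
qed (auto simp: sup_ordinal_def inf_ordinal_def)

end

definition osuc :: "ordinal \<Rightarrow> ordinal" where
  "osuc a = (LEAST b. a < b)"

lemma Sup_ordinal_empty: "Sup {} = (0::ordinal)"
  by (simp add: Sup_ordinal_def zero_ordinal_def)

lemma one_ordinal_eq: "1 = osuc 0"
  by (simp add: osuc_def one_ordinal_def)


section \<open>Families of finite subsets of the positive integers\<close>

text \<open>The index set of the mathematics is \<open>{1..} :: nat set\<close>; \<^term>\<open>Fpow M\<close> is the set of finite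
  subsets of \<open>M\<close>.\<close>

text \<open>\<open>elt s k\<close> is the \<open>k\<close>-th element of \<open>s\<close>, counting from 1; it is meaningful for
  \<open>1 \<le> k\<close>, and \<open>k \<le> card s\<close> if \<open>s\<close> is finite.\<close>
definition elt :: "nat set \<Rightarrow> nat \<Rightarrow> nat" where
  "elt s k = enumerate s (k - 1)"

definition init_seg :: "nat set \<Rightarrow> nat set \<Rightarrow> bool" (infix "\<sqsubseteq>" 50) where
  "t \<sqsubseteq> s \<longleftrightarrow> t \<subseteq> s \<and> (\<forall>x\<in>t. \<forall>y\<in>s. y \<le> x \<longrightarrow> y \<in> t)"

definition proper_init_seg :: "nat set \<Rightarrow> nat set \<Rightarrow> bool" (infix "\<sqsubset>" 50) where
  "t \<sqsubset> s \<longleftrightarrow> t \<sqsubseteq> s \<and> t \<noteq> s"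

definition restr :: "nat set set \<Rightarrow> nat set \<Rightarrow> nat set set" (infixl "\<restriction>" 90) where
  "F \<restriction> M = F \<inter> Fpow M"

definition hat :: "nat set set \<Rightarrow> nat set set" where
  "hat F = {t \<in> Fpow {1..}. \<exists>s\<in>F. t \<sqsubseteq> s}"

definition hereditary :: "nat set set \<Rightarrow> bool" where
  "hereditary R \<longleftrightarrow> (\<forall>s\<in>R. \<forall>t. t \<subseteq> s \<longrightarrow> t \<in> R)"

definition spreading :: "nat set set \<Rightarrow> bool" where
  "spreading R \<longleftrightarrow> (\<forall>s\<in>R. \<forall>t\<in>Fpow {1..}.
     card t = card s \<and> (\<forall>i\<in>{1..card s}. elt s i \<le> elt t i) \<longrightarrow> t \<in> R)"

definition compact_family :: "nat set set \<Rightarrow> bool" where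
  "compact_family R \<longleftrightarrow>
     closedin (product_topology (\<lambda>_. discrete_topology {0, 1::nat}) {1::nat..})
       ((\<lambda>s. restrict (indicator s) {1..}) ` R)"

definition regular :: "nat set set \<Rightarrow> bool" where
  "regular R \<longleftrightarrow> R \<noteq> {} \<and> R \<subseteq> Fpow {1..} \<and> hereditary R \<and> spreading R \<and> compact_family R"

definition thin :: "nat set set \<Rightarrow> bool" where
  "thin F \<longleftrightarrow> \<not> (\<exists>s\<in>F. \<exists>t\<in>F. s \<sqsubset> t)"

definition regular_thin :: "nat set set \<Rightarrow> bool" where
  "regular_thin F \<longleftrightarrow> F \<subseteq> Fpow {1..} \<and> thin F \<and> regular (hat F)"


section \<open>The order of a family\<close>

definition has_infinite_chain :: "nat set set \<Rightarrow> bool" where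
  "has_infinite_chain T \<longleftrightarrow> (\<exists>f :: nat \<Rightarrow> nat set. \<forall>n. f n \<in> T \<and> f n \<sqsubset> f (Suc n))"

text \<open>The recursion on \<open>\<sqsubset>\<close> inside \<open>T\<close> is well-founded iff there is no infinite chain. For a
  family of finite sets of naturals all ranks are then countable ordinals, so the suprema below
  are of sets bounded by \<^term>\<open>omega1\<close>.\<close>
definition tree_rank :: "nat set set \<Rightarrow> nat set \<Rightarrow> ordinal" where
  "tree_rank T = wfrec {(t, s). t \<in> T \<and> s \<in> T \<and> s \<sqsubset> t}
     (\<lambda>o_T s. SUP t\<in>{t \<in> T. s \<sqsubset> t}. osuc (o_T t))"

definition family_order :: "nat set set \<Rightarrow> ordinal" where
  "family_order F = (if has_infinite_chain (hat F) then omega1 else tree_rank (hat F) {})"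

lemma tree_rank_eq:
  assumes "\<not> has_infinite_chain T" and "s \<in> T"
  shows "tree_rank T s = (SUP t\<in>{t \<in> T. s \<sqsubset> t}. osuc (tree_rank T t))"
proof -
  let ?R = "{(t, s). t \<in> T \<and> s \<in> T \<and> s \<sqsubset> t}"
  have "wf ?R"
    using assms(1) by (auto simp: wf_iff_no_infinite_down_chain has_infinite_chain_def)
  then have "tree_rank T s = (SUP t\<in>{t \<in> T. s \<sqsubset> t}. osuc (cut (tree_rank T) ?R s t))"
    unfolding tree_rank_def by (subst wfrec) auto
  also have "\<dots> = (SUP t\<in>{t \<in> T. s \<sqsubset> t}. osuc (tree_rank T t))"
    using assms(2) by (intro SUP_cong) (auto simp: cut_apply)
  finally show ?thesis .
qed

lemma tree_rank_maximal:
  assumes "\<not> has_infinite_chain T" and "s \<in> T" and "\<not> (\<exists>t\<in>T. s \<sqsubset> t)"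
  shows "tree_rank T s = 0"
proof -
  have "{t \<in> T. s \<sqsubset> t} = {}"
    using assms(3) by blast
  then show ?thesis
    unfolding tree_rank_eq[OF assms(1,2)] by (simp only: image_empty Sup_ordinal_empty)
qed


section \<open>Plegma families and spreading models\<close>

definition plegma :: "nat \<Rightarrow> (nat \<Rightarrow> nat set) \<Rightarrow> bool" where
  "plegma k s \<longleftrightarrow>
     (\<forall>i\<in>{1..k}. s i \<noteq> {} \<and> s i \<in> Fpow {1..}) \<and>
     (\<forall>i\<in>{1..k}. \<forall>j\<in>{1..k}. i < j \<longrightarrow>
        (\<forall>m\<in>{1..min (card (s i)) (card (s j))}. elt (s i) m < elt (s j) m)) \<and>
     (\<forall>i\<in>{1..k}. \<forall>j\<in>{1..k}.
        (\<forall>m\<in>{1..min (card (s i)) (card (s j) - 1)}. elt (s i) m < elt (s j) (m + 1)))"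

definition Plm :: "nat \<Rightarrow> nat set set \<Rightarrow> (nat \<Rightarrow> nat set) set" where
  "Plm k F = {s \<in> {1..k} \<rightarrow>\<^sub>E F. plegma k s}"

definition seminorm :: "('e::real_vector \<Rightarrow> real) \<Rightarrow> bool" where
  "seminorm p \<longleftrightarrow> (\<forall>x. 0 \<le> p x) \<and> (\<forall>x y. p (x + y) \<le> p x + p y) \<and>
     (\<forall>c x. p (c *\<^sub>R x) = \<bar>c\<bar> * p x)"

text \<open>Having a Hamel basis indexed by the positive integers makes the space infinite dimensional.\<close>
definition hamel_basis :: "(nat \<Rightarrow> 'e::real_vector) \<Rightarrow> bool" where
  "hamel_basis e \<longleftrightarrow> inj_on e {1..} \<and> independent (e ` {1..}) \<and> span (e ` {1..}) = UNIV"

text \<open>An \<open>F\<close>-sequence is a function on \<^typ>\<open>nat set\<close> of which only the values on \<open>F\<close> are used.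
  The value \<open>\<delta> 0\<close> plays no role.\<close>
definition generates_spreading_model ::
  "nat set set \<Rightarrow> nat set \<Rightarrow> (nat set \<Rightarrow> 'a::real_normed_vector) \<Rightarrow>
   ('e::real_vector \<Rightarrow> real) \<Rightarrow> (nat \<Rightarrow> 'e) \<Rightarrow> bool" where
  "generates_spreading_model F M x p e \<longleftrightarrow>
     (\<exists>\<delta> :: nat \<Rightarrow> real. (\<forall>n\<ge>1. 0 < \<delta> n) \<and> \<delta> \<longlonglongrightarrow> 0 \<and>
       (\<forall>l\<ge>1. \<forall>k\<in>{1..l}. \<forall>a :: nat \<Rightarrow> real. (\<forall>j\<in>{1..k}. a j \<in> {-1..1}) \<longrightarrow>
         (\<forall>s\<in>Plm k (F \<restriction> M). elt M l \<le> elt (s 1) 1 \<longrightarrow>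
           \<bar>norm (\<Sum>j=1..k. a j *\<^sub>R x (s j)) - p (\<Sum>j=1..k. a j *\<^sub>R e j)\<bar> \<le> \<delta> l)))"

definition admits_spreading_model ::
  "nat set set \<Rightarrow> (nat set \<Rightarrow> 'a::real_normed_vector) \<Rightarrow>
   ('e::real_vector \<Rightarrow> real) \<Rightarrow> (nat \<Rightarrow> 'e) \<Rightarrow> bool" where
  "admits_spreading_model F x p e \<longleftrightarrow>
     (\<exists>M. M \<subseteq> {1..} \<and> infinite M \<and> generates_spreading_model F M x p e)"

end

theory Submission
  imports Defs "HOL-Library.Countable_Set_Type"
begin

text \<open>
  Every \<open>t\<close> in \<open>G\<close> with elements in a suitable infinite set \<open>N\<close> is sent to some \<open>\<phi> t\<close> in \<open>F\<close>, and
  \<open>w\<^sub>t = x\<^bsub>\<phi> t\<^esub>\<close>. To keep the spreading model, \<open>\<phi>\<close> must turn plegma families into plegma families.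
  Two operations do so: taking images under an increasing map, and shortening each member to a
  nonempty initial segment (\<open>plegma_transfer\<close>). So let \<open>\<phi> t\<close> be an initial segment in \<open>F\<close>
  of \<open>h ` t\<close>, where \<open>h\<close> is the increasing bijection from \<open>N = {n 0 < n 1 < \<dots>}\<close> onto a set
  \<open>{m 0 < m 1 < \<dots>}\<close> inside the set that generates the given model. The model for \<open>G\<close> then comes
  with the same error sequence, and it remains to choose \<open>m\<close> and \<open>n\<close> so that
  \<open>h ` t\<close> has an initial segment in \<open>F\<close> for all \<open>t \<in> G\<close> with \<open>t \<subseteq> N\<close>.

  Since \<open>hat F\<close> is spreading, a member of it that is not maximal can be prolonged by every
  sufficiently large number. A diagonal choice of \<open>m\<close> (\<open>very_large_sequence\<close>) therefore makes each
  finite \<open>m ` I\<close> either have an initial segment in \<open>F\<close> or be itself in \<open>hat F\<close>. Only the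
  second case is dangerous, and this is where the orders enter. A second diagonal choice
  (\<open>rank_dominating_sequence\<close>) gives \<open>n\<close> such that, whenever \<open>m ` I\<close> is in \<open>hat F\<close>, the set \<open>n ` I\<close>
  is in \<open>hat G\<close> with at least the rank of \<open>m ` I\<close>: this holds for \<open>I = {}\<close> because
  \<open>o(F) \<le> o(G)\<close>, and it propagates since adding \<open>m k\<close> strictly lowers the rank in \<open>hat F\<close>,
  while in \<open>hat G\<close> any rank below that of \<open>n ` I\<close> is reached by adding one point, and keeps being
  reached when the point moves to the right (\<open>tree_rank_spread\<close>). If now
  \<open>t = n ` I\<close> is in \<open>G\<close>, then it is maximal in \<open>hat G\<close> and has rank 0; so if \<open>m ` I\<close> is in
  \<open>hat F\<close>, it has rank 0 as well, is maximal, and belongs to \<open>F\<close>.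

  Besides rank 0 at maximal sets, the argument uses two facts about ranks: proper extensions have
  smaller rank, and every ordinal below the rank of \<open>s\<close> is at most the rank of some proper extension of \<open>s\<close>.
\<close>

section \<open>Ranks as ordinals\<close>

context
  includes cardinal_syntax
begin

text \<open>Suprema and successors of ordinals have their expected meaning only where upper bounds
  exist. The bounds come from the regularity of \<open>\<aleph>\<^sub>1\<close>: an ordinal below \<^term>\<open>omega1\<close> is the
  type of a proper initial segment of \<open>cardSuc natLeq\<close>, and the countably many endpoints of these
  segments are not cofinal.\<close>
lemma countable_below_omega1_bounded:
  assumes "countable A" and "A \<subseteq> {..<omega1}"
  obtains b where "b < omega1" and "\<And>a. a \<in> A \<Longrightarrow> a < b"
proof -
  define W :: "nat set rel" where "W = cardSuc natLeq"
  have "Card_order W"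
    by (simp add: W_def cardSuc_Card_order natLeq_Card_order)
  then have W: "Card_order W" "Well_order W"
    by (simp_all add: card_order_on_def)
  have inf: "infinite (Field W)"
    unfolding W_def using cardSuc_finite[OF natLeq_Card_order] by (simp add: Field_natLeq)
  have reg: "regularCard W"
    unfolding W_def by (rule regularCard_cardSuc) (simp add: natLeq_Cinfinite)
  define seg where "seg x = Restr W (underS W x)" for x
  have segW: "Well_order (seg x)" for x
    unfolding seg_def by (rule Well_order_Restr[OF W(2)])
  have eqs: "(seg x, seg x) \<in> ordIso" "(W, W) \<in> ordIso" for x
    using segW W by (auto intro: ordIso_reflexive)
  have om: "omega1 = abs_ordinal W"
    by (simp add: omega1_def W_def)
  have "\<exists>x\<in>Field W. a = abs_ordinal (seg x)" if "a \<in> A" for a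
  proof -
    have "\<exists>r. (r, r) \<in> ordIso \<and> a = abs_ordinal r"
      by (induct a rule: ordinal.abs_induct) blast
    then obtain r where r: "(r, r) \<in> ordIso" "a = abs_ordinal r"
      by blast
    have "abs_ordinal r < abs_ordinal W"
      using that assms(2) r om by auto
    then have "r <o W"
      using less_ordinal.abs_eq[OF r(1) eqs(2)] by simp
    moreover have "Well_order r"
      using r(1) by (auto simp: ordIso_def)
    ultimately obtain x where "x \<in> Field W" "r =o seg x"
      unfolding seg_def using ordLess_iff_ordIso_Restr[OF W(2)] by blast
    then show ?thesis
      using r(2) Quotient_rel_abs[OF Quotient_ordinal] by blast
  qed
  then obtain f where f: "\<And>a. a \<in> A \<Longrightarrow> f a \<in> Field W" "\<And>a. a \<in> A \<Longrightarrow> a = abs_ordinal (seg (f a))"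
    by metis
  have "|f ` A| \<le>o natLeq"
    using assms(1) countable_card_le_natLeq by blast
  then have "\<not> |f ` A| =o W"
    using cardSuc_greater[OF natLeq_Card_order] unfolding W_def
    by (meson not_ordLess_ordIso ordLeq_ordLess_trans)
  then have "\<not> cofinal (f ` A) W"
    using reg f(1) unfolding regularCard_def by blast
  then obtain y where y: "y \<in> Field W" "\<And>a. a \<in> A \<Longrightarrow> y = f a \<or> (y, f a) \<notin> W"
    unfolding cofinal_def by blast
  (* y bounds the endpoints only weakly; a later z makes the bound strict. *)
  obtain z where z: "z \<in> Field W" "y \<noteq> z" "(y, z) \<in> W"
    using infinite_Card_order_limit[OF W(1) inf y(1)] by blast
  have wo: "wo_rel W"
    using W(2) by (simp add: wo_rel_def)
  have of: "wo_rel.ofilter W (underS W x)" for x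
    by (rule wo_rel.underS_ofilter[OF wo])
  have seg_less: "abs_ordinal (seg u) < abs_ordinal (seg v)"
    if "(u, v) \<in> W" "u \<noteq> v" for u v
  proof -
    have "underS W u \<subseteq> underS W v"
      using underS_incr[of W u v] wo_rel.TRANS[OF wo] wo_rel.ANTISYM[OF wo] that by blast
    moreover have "u \<in> underS W v" "u \<notin> underS W u"
      using that by (auto simp: underS_def)
    ultimately have "seg u <o seg v"
      unfolding seg_def using ofilter_subset_ordLess[OF W(2) of of] by blast
    then show ?thesis
      using less_ordinal.abs_eq[OF eqs(1) eqs(1)] by simp
  qed
  show thesis
  proof
    have "seg z <o W"
      unfolding seg_def using underS_Restr_ordLess[OF W(2)] z(1) by blast
    then show "abs_ordinal (seg z) < omega1"
      unfolding om using less_ordinal.abs_eq[OF eqs(1) eqs(2)] by simp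
  next
    fix a assume a: "a \<in> A"
    have "(f a, y) \<in> W"
      using wo_rel.TOTALS[OF wo] wo_rel.REFL[OF wo] y f(1)[OF a] a
      by (metis refl_on_def)
    then have "(f a, z) \<in> W" "f a \<noteq> z"
      using wo_rel.TRANS[OF wo] wo_rel.ANTISYM[OF wo] z by (blast dest: transD antisymD)+
    then show "a < abs_ordinal (seg z)"
      using seg_less f(2)[OF a] by metis
  qed
qed

end

lemma ordinal_zero_le: "0 \<le> (a :: ordinal)"
  by (simp add: zero_ordinal_def Least_le)

lemma osuc_le: "a < b \<Longrightarrow> osuc a \<le> b"
  by (simp add: osuc_def Least_le)

lemma less_osuc:
  assumes "a < omega1"
  shows "a < osuc a"
  unfolding osuc_def using assms by (rule LeastI)

lemma zero_less_one_ordinal: "0 < (1 :: ordinal)"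
proof -
  obtain b where "b < omega1"
    using countable_below_omega1_bounded[of "{}"] by auto
  then show ?thesis
    using less_osuc[of 0] ordinal_zero_le by (metis one_ordinal_eq order_le_less_trans)
qed

lemma countable_finite_sets:
  assumes "T \<subseteq> Fpow {1::nat..}"
  shows "countable T"
  using countable_subset[OF assms countable_Fpow] by simp

lemma wf_proper_extension:
  assumes "\<not> has_infinite_chain T"
  shows "wf {(t, s). t \<in> T \<and> s \<in> T \<and> s \<sqsubset> t}"
  using assms by (auto simp: wf_iff_no_infinite_down_chain has_infinite_chain_def)

text \<open>Only countably many finite sets of naturals exist, so each rank is a supremum of countably
  many smaller ranks and countability propagates along the tree.\<close>
lemma tree_rank_below_omega1:
  assumes T: "T \<subseteq> Fpow {1..}" "\<not> has_infinite_chain T" and "s \<in> T"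
  shows "tree_rank T s < omega1"
  using wf_proper_extension[OF T(2)] \<open>s \<in> T\<close>
proof (induction s)
  case (less s)
  let ?A = "tree_rank T ` {t \<in> T. s \<sqsubset> t}"
  have "countable {t \<in> T. s \<sqsubset> t}"
    using countable_finite_sets[OF T(1)] by (rule countable_subset[rotated]) auto
  moreover have "?A \<subseteq> {..<omega1}"
    using less by auto
  ultimately obtain b where b: "b < omega1" "\<And>a. a \<in> ?A \<Longrightarrow> a < b"
    using countable_below_omega1_bounded[of ?A] by auto
  have "tree_rank T s \<le> b"
  proof (cases "{t \<in> T. s \<sqsubset> t} = {}")
    case True
    then show ?thesis
      using tree_rank_maximal[OF T(2) less.prems] ordinal_zero_le by auto
  next
    case False
    then show ?thesis
      unfolding tree_rank_eq[OF T(2) less.prems]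
      using b(2) by (intro cSUP_least osuc_le) auto
  qed
  then show ?case
    using b(1) by simp
qed

lemma tree_rank_less:
  assumes T: "T \<subseteq> Fpow {1..}" "\<not> has_infinite_chain T" and "s \<in> T" "t \<in> T" "s \<sqsubset> t"
  shows "tree_rank T t < tree_rank T s"
proof -
  have "bdd_above ((\<lambda>t. osuc (tree_rank T t)) ` {t \<in> T. s \<sqsubset> t})"
    using tree_rank_below_omega1[OF T] by (auto intro!: bdd_aboveI[of _ omega1] osuc_le)
  then have "osuc (tree_rank T t) \<le> tree_rank T s"
    unfolding tree_rank_eq[OF T(2) \<open>s \<in> T\<close>] using assms by (intro cSUP_upper) auto
  then show ?thesis
    using less_osuc[OF tree_rank_below_omega1[OF T \<open>t \<in> T\<close>]] by simp
qed

text \<open>This is the defining supremum read from below: if all proper extensions had rank less than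
  \<open>a\<close>, then \<open>a\<close> would be an upper bound.\<close>
lemma less_tree_rankE:
  assumes T: "\<not> has_infinite_chain T" and "s \<in> T" "a < tree_rank T s"
  obtains t where "t \<in> T" "s \<sqsubset> t" "a \<le> tree_rank T t"
proof (rule ccontr)
  assume "\<not> thesis"
  with that have *: "\<And>t. t \<in> T \<Longrightarrow> s \<sqsubset> t \<Longrightarrow> tree_rank T t < a"
    by (meson not_le)
  have "tree_rank T s \<le> a"
  proof (cases "{t \<in> T. s \<sqsubset> t} = {}")
    case True
    then show ?thesis
      using tree_rank_maximal[OF T \<open>s \<in> T\<close>] ordinal_zero_le by auto
  next
    case False
    then show ?thesis
      unfolding tree_rank_eq[OF T \<open>s \<in> T\<close>]
      using * by (intro cSUP_least osuc_le) auto
  qed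
  with assms(3) show False by simp
qed

section \<open>Initial segments and regular families\<close>

lemma compact_family_pointwise_limit:
  fixes R :: "nat set set" and f :: "nat \<Rightarrow> nat set"
  assumes R: "R \<subseteq> Fpow {1..}" "compact_family R"
    and f: "\<And>n. f n \<in> R"
    and U: "U \<subseteq> {1..}" "\<And>i. \<forall>\<^sub>F n in sequentially. i \<in> f n \<longleftrightarrow> i \<in> U"
  shows "U \<in> R"
proof -
  let ?X = "product_topology (\<lambda>_. discrete_topology {0, 1::nat}) {1::nat..}"
  let ?\<chi> = "\<lambda>s :: nat set. restrict (indicator s :: nat \<Rightarrow> nat) {1..}"
  have "limitin ?X (\<lambda>n. ?\<chi> (f n)) (?\<chi> U) sequentially"
    unfolding limitin_componentwise
  proof (intro conjI ballI)
    show "\<forall>\<^sub>F n in sequentially. ?\<chi> (f n) \<in> topspace ?X"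
      by (intro always_eventually) (auto simp: indicator_def)
  next
    fix i :: nat assume "i \<in> {1..}"
    then show "limitin (discrete_topology {0, 1}) (\<lambda>n. ?\<chi> (f n) i) (?\<chi> U i) sequentially"
      unfolding limitin_def
    proof (intro conjI allI impI)
      show "?\<chi> U i \<in> topspace (discrete_topology {0, 1})"
        using \<open>i \<in> {1..}\<close> by (simp add: indicator_def)
    next
      fix V assume V: "openin (discrete_topology {0, 1}) V \<and> ?\<chi> U i \<in> V"
      show "\<forall>\<^sub>F n in sequentially. ?\<chi> (f n) i \<in> V"
        using U(2)[of i]
      proof eventually_elim
        case (elim n)
        then have "?\<chi> (f n) i = ?\<chi> U i" by (simp add: indicator_def)
        then show ?case using V by simp
      qed
    qed
  qed auto
  then have "?\<chi> U \<in> ?\<chi> ` R"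
  proof (rule limitin_closedin)
    show "closedin ?X (?\<chi> ` R)"
      using R(2) by (simp add: compact_family_def)
    show "\<forall>\<^sub>F n in sequentially. ?\<chi> (f n) \<in> ?\<chi> ` R"
      using f by (intro always_eventually allI imageI)
  qed simp
  then obtain s where s: "s \<in> R" "?\<chi> U = ?\<chi> s"
    by blast
  have "s \<subseteq> {1..}"
    using s(1) R(1) by (auto simp: Fpow_def)
  moreover have "i \<in> U \<longleftrightarrow> i \<in> s" if "i \<ge> 1" for i
    using fun_cong[OF s(2), of i] that by (cases "i \<in> U"; cases "i \<in> s") auto
  ultimately have "U = s"
    using U(1) by blast
  then show ?thesis using s(1) by simp
qed

lemma init_seg_trans: "a \<sqsubseteq> b \<Longrightarrow> b \<sqsubseteq> c \<Longrightarrow> a \<sqsubseteq> c"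
  unfolding init_seg_def by blast

text \<open>The union of an infinite chain is the pointwise limit of its members, hence would be an infinite
  member of the family.\<close>
lemma regular_no_infinite_chain:
  assumes "regular R"
  shows "\<not> has_infinite_chain R"
proof
  assume "has_infinite_chain R"
  then obtain f where f: "\<And>n. f n \<in> R" "\<And>n. f n \<sqsubset> f (Suc n)"
    unfolding has_infinite_chain_def by blast
  have R: "R \<subseteq> Fpow {1..}" "compact_family R"
    using assms by (auto simp: regular_def)
  have step: "f n \<subset> f (Suc n)" for n
    using f(2)[of n] by (auto simp: proper_init_seg_def init_seg_def)
  have mono: "f m \<subseteq> f n" if "m \<le> n" for m n
    using that step by (meson lift_Suc_mono_le psubset_imp_subset)
  let ?U = "\<Union>n. f n"
  have "?U \<in> R"
  proof (rule compact_family_pointwise_limit[OF R f(1)])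
    show "?U \<subseteq> {1..}"
      using f(1) R(1) by (fastforce simp: Fpow_def)
    show "\<forall>\<^sub>F n in sequentially. i \<in> f n \<longleftrightarrow> i \<in> ?U" for i
    proof (cases "i \<in> ?U")
      case True
      then obtain m where "i \<in> f m" by blast
      then show ?thesis
        using mono True unfolding eventually_sequentially by blast
    qed auto
  qed
  then have fin: "finite ?U"
    using R(1) by (auto simp: Fpow_def)
  have "n \<le> card (f n)" for n
  proof (induction n)
    case (Suc n)
    have "card (f n) < card (f (Suc n))"
      by (rule psubset_card_mono[OF finite_subset[OF _ fin] step]) auto
    with Suc show ?case by simp
  qed simp
  then have "Suc (card ?U) \<le> card (f (Suc (card ?U)))" .
  also have "\<dots> \<le> card ?U"
    by (rule card_mono[OF fin]) auto
  finally show False by simp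
qed

lemma enumerate_0_in: "s \<noteq> {} \<Longrightarrow> enumerate s 0 \<in> s"
  for s :: "nat set"
  by (metis LeastI_ex ex_in_conv enumerate_0)

lemma enumerate_0_le: "y \<in> s \<Longrightarrow> enumerate s 0 \<le> y"
  for s :: "nat set"
  by (simp add: enumerate_0 Least_le)

lemma enumerate_0_eqI:
  fixes s :: "nat set"
  assumes "a \<in> s" and "\<And>y. y \<in> s \<Longrightarrow> a \<le> y"
  shows "enumerate s 0 = a"
  using assms by (simp add: enumerate_0 Least_equality)

lemma enumerate_image:
  fixes f :: "nat \<Rightarrow> nat"
  assumes "strict_mono_on s f" and "infinite s \<or> i < card s"
  shows "enumerate (f ` s) i = f (enumerate s i)"
  using assms
proof (induction i arbitrary: s)
  case (0 s)
  then have "s \<noteq> {}" by auto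
  then show ?case
    using strict_mono_on_leD[OF 0(1)]
    by (intro enumerate_0_eqI) (auto intro: enumerate_0_in enumerate_0_le)
next
  case (Suc i s)
  let ?a = "enumerate s 0"
  have "s \<noteq> {}" using Suc.prems(2) by auto
  then have a: "?a \<in> s" by (rule enumerate_0_in)
  then have 0: "enumerate (f ` s) 0 = f ?a"
    using strict_mono_on_leD[OF Suc.prems(1)]
    by (intro enumerate_0_eqI) (auto intro: enumerate_0_le)
  have "inj_on f s"
    using Suc.prems(1) by (rule strict_mono_on_imp_inj_on)
  then have "f ` s - {f ?a} = f ` (s - {?a})"
    using a by (auto simp: inj_on_def)
  moreover have "strict_mono_on (s - {?a}) f"
    using Suc.prems(1) by (auto simp: strict_mono_on_def)
  moreover have "infinite (s - {?a}) \<or> i < card (s - {?a})"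
    using Suc.prems(2) a by auto
  ultimately show ?case
    using Suc.IH[of "s - {?a}"] by (simp add: enumerate_Suc' 0)
qed

lemma enumerate_init_seg:
  assumes "s \<sqsubseteq> t" and "i < card s"
  shows "enumerate s i = enumerate t i"
  using assms
proof (induction i arbitrary: s t)
  case (0 s t)
  then have "s \<noteq> {}" by auto
  then have a: "enumerate s 0 \<in> s" by (rule enumerate_0_in)
  have "enumerate t 0 = enumerate s 0"
    using a 0(1) unfolding init_seg_def
    by (intro enumerate_0_eqI) (blast, metis enumerate_0_le nle_le)
  then show ?case by simp
next
  case (Suc i s t)
  let ?a = "enumerate s 0"
  have "s \<noteq> {}" using Suc.prems(2) by auto
  then have a: "?a \<in> s" by (rule enumerate_0_in)
  have 0: "enumerate t 0 = ?a"
    using a Suc.prems(1) unfolding init_seg_def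
    by (intro enumerate_0_eqI) (blast, metis enumerate_0_le nle_le)
  have "s - {?a} \<sqsubseteq> t - {?a}"
    using Suc.prems(1) by (auto simp: init_seg_def)
  moreover have "i < card (s - {?a})"
    using Suc.prems(2) a by auto
  ultimately show ?case
    using Suc.IH[of "s - {?a}" "t - {?a}"] by (simp add: enumerate_Suc' 0)
qed

lemma proper_init_seg_image:
  assumes "strict_mono_on t g" and "s \<sqsubset> t"
  shows "g ` s \<sqsubset> g ` t"
proof -
  have st: "s \<subseteq> t" and below: "\<And>x y. x \<in> s \<Longrightarrow> y \<in> t \<Longrightarrow> y \<le> x \<Longrightarrow> y \<in> s"
    using assms(2) by (auto simp: proper_init_seg_def init_seg_def)
  have "y \<in> g ` s" if "x \<in> g ` s" "y \<in> g ` t" "y \<le> x" for x y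
  proof -
    obtain u v where uv: "u \<in> s" "v \<in> t" "y = g v" "g v \<le> g u"
      using \<open>x \<in> g ` s\<close> \<open>y \<in> g ` t\<close> \<open>y \<le> x\<close> by blast
    then have "\<not> u < v"
      using strict_mono_onD[OF assms(1), of u v] st by auto
    then show ?thesis
      using below uv by auto
  qed
  moreover have "g ` s \<noteq> g ` t"
    using inj_on_image_eq_iff[OF strict_mono_on_imp_inj_on[OF assms(1)] st] assms(2)
    by (auto simp: proper_init_seg_def)
  ultimately show ?thesis
    using st unfolding proper_init_seg_def init_seg_def by blast
qed

lemma image_insert_above:
  fixes m :: "nat \<Rightarrow> nat"
  assumes "strict_mono m" and "I \<subseteq> {..<k}"
  shows "m ` I \<sqsubset> m ` insert k I"
proof (rule proper_init_seg_image)
  show "strict_mono_on (insert k I) m"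
    using assms(1) by (auto simp: strict_mono_on_def strict_mono_def)
  show "I \<sqsubset> insert k I"
    using assms(2) by (auto simp: proper_init_seg_def init_seg_def)
qed
text \<open>Spreading is used throughout in this form, with the shift given as an increasing map, because
  such maps can be prolonged to larger sets.\<close>
lemma spreading_image:
  assumes "spreading R" "s \<in> R" "s \<in> Fpow {1..}"
    and f: "strict_mono_on s f" "\<And>x. x \<in> s \<Longrightarrow> x \<le> f x"
  shows "f ` s \<in> R"
proof -
  have fin: "finite s" using assms(3) by (simp add: Fpow_def)
  have "f ` s \<in> Fpow {1..}"
    using assms(3) f(2) by (fastforce simp: Fpow_def)
  moreover have c: "card (f ` s) = card s"
    using strict_mono_on_imp_inj_on[OF f(1)] by (rule card_image)
  moreover have "elt s i \<le> elt (f ` s) i" if "i \<in> {1..card s}" for i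
    unfolding elt_def using that fin f
    by (subst enumerate_image[OF f(1)]) (auto simp: finite_enumerate_in_set)
  ultimately show ?thesis
    using assms(1,2) unfolding spreading_def by blast
qed

text \<open>Moving elements to the right does not lower the rank: an extension \<open>t\<close> of \<open>s\<close> is carried along by
  shifting its new elements far enough to the right, which gives an extension of the image of \<open>s\<close>
  whose rank is, by induction, at least that of \<open>t\<close>.\<close>
lemma tree_rank_spread:
  assumes R: "regular R" and "s \<in> R"
    and "strict_mono_on s f" "\<And>x. x \<in> s \<Longrightarrow> x \<le> f x"
  shows "tree_rank R s \<le> tree_rank R (f ` s)"
proof -
  have R': "R \<subseteq> Fpow {1..}" "spreading R" "\<not> has_infinite_chain R"
    using R regular_no_infinite_chain by (auto simp: regular_def)
  show ?thesis
    using wf_proper_extension[OF R'(3)] assms(2-)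
  proof (induction s arbitrary: f)
    case (less s f)
    have fs: "f ` s \<in> R"
      using spreading_image[OF R'(2) less.prems(1) _ less.prems(2,3)] less.prems(1) R'(1) by blast
    show ?case
    proof (rule ccontr)
      assume "\<not> ?case"
      then obtain t where t: "t \<in> R" "s \<sqsubset> t" "tree_rank R (f ` s) \<le> tree_rank R t"
        using less_tree_rankE[OF R'(3) less.prems(1)] by (metis not_le)
      have fin: "finite s" using less.prems(1) R'(1) by (auto simp: Fpow_def)
      (* The added constant puts the new elements of t above all of f ` s; the inserted 0 covers an
         empty s. *)
      define g where "g = (\<lambda>x. if x \<in> s then f x else x + Suc (Max (insert 0 (f ` s))))"
      have fb: "f x < y + Suc (Max (insert 0 (f ` s)))" if "x \<in> s" for x y
      proof -
        have "f x \<le> Max (insert 0 (f ` s))"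
          using fin that by (intro Max_ge) auto
        then show ?thesis by linarith
      qed
      have below: "x < y" if "x \<in> s" "y \<in> t" "y \<notin> s" for x y
        using t(2) that unfolding proper_init_seg_def init_seg_def by (meson not_le)
      have gs: "g ` s = f ` s" by (auto simp: g_def)
      have mono: "strict_mono_on t g"
      proof (rule strict_mono_onI)
        fix x y assume xy: "x \<in> t" "y \<in> t" "x < y"
        show "g x < g y"
          using xy fb[of x y] below[of y x] strict_mono_onD[OF less.prems(2), of x y]
          by (auto simp: g_def)
      qed
      have ge: "x \<le> g x" if "x \<in> t" for x
        using less.prems(3)[of x] by (auto simp: g_def)
      have gt: "g ` t \<in> R"
        using spreading_image[OF R'(2) t(1) _ mono ge] t(1) R'(1) by blast
      have "f ` s \<sqsubset> g ` t"
        using proper_init_seg_image[OF mono t(2)] by (simp add: gs)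
      then have "tree_rank R (g ` t) < tree_rank R (f ` s)"
        by (rule tree_rank_less[OF R'(1,3) fs gt])
      moreover have "tree_rank R t \<le> tree_rank R (g ` t)"
        by (rule less.IH) (use t less.prems mono ge in auto)
      ultimately show False using t(3) by simp
    qed
  qed
qed

lemma regular_subset:
  "regular R \<Longrightarrow> t \<in> R \<Longrightarrow> s \<subseteq> t \<Longrightarrow> s \<in> R"
  by (auto simp: regular_def hereditary_def)

text \<open>Cutting \<open>t\<close> down to the first element beyond \<open>s\<close> does not lower the rank, and neither does
  moving that element to the right. This makes both diagonal constructions below possible.\<close>
lemma eventually_one_point_extension:
  assumes R: "regular R" and "s \<in> R" and "t \<in> R" "s \<sqsubset> t"
  shows "\<forall>\<^sub>F v in sequentially. insert v s \<in> R \<and> tree_rank R t \<le> tree_rank R (insert v s)"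
proof -
  have R': "R \<subseteq> Fpow {1..}" "spreading R" "\<not> has_infinite_chain R"
    using R regular_no_infinite_chain by (auto simp: regular_def)
  have st: "s \<subseteq> t" "t - s \<noteq> {}"
    using assms(4) unfolding proper_init_seg_def init_seg_def by blast+
  have below: "x < y" if "x \<in> s" "y \<in> t - s" for x y
    using assms(4) that unfolding proper_init_seg_def init_seg_def by (meson DiffE not_le)
  have fin: "finite t" using assms(3) R'(1) by (auto simp: Fpow_def)
  define v where "v = Min (t - s)"
  have v: "v \<in> t - s" unfolding v_def using fin st by (intro Min_in) auto
  have vmin: "v \<le> y" if "y \<in> t - s" for y
    unfolding v_def using fin that by simp
  have sub: "insert v s \<subseteq> t" using v st by auto
  have vs: "insert v s \<in> R" by (rule regular_subset[OF R assms(3) sub])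
  have "insert v s \<sqsubseteq> t"
    unfolding init_seg_def
  proof (intro conjI ballI impI sub)
    fix x y assume xy: "x \<in> insert v s" "y \<in> t" "y \<le> x"
    show "y \<in> insert v s"
    proof (rule ccontr)
      assume y: "y \<notin> insert v s"
      then have "v \<le> y" "\<And>z. z \<in> s \<Longrightarrow> z < y" using vmin below xy by auto
      then show False using xy y by fastforce
    qed
  qed
  then have 1: "tree_rank R t \<le> tree_rank R (insert v s)"
    using tree_rank_less[OF R'(1,3) vs assms(3)] by (cases "insert v s = t") (auto simp: proper_init_seg_def)
  have "insert w s \<in> R \<and> tree_rank R t \<le> tree_rank R (insert w s)" if "w \<ge> v" for w
  proof -
    let ?f = "id(v := w)"
    have m: "strict_mono_on (insert v s) ?f"
      using that below[OF _ v] v by (intro strict_mono_onI) (fastforce split: if_splits)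
    have g: "\<And>x. x \<in> insert v s \<Longrightarrow> x \<le> ?f x" using that by auto
    have im: "?f ` insert v s = insert w s" using v by auto
    show ?thesis
      using spreading_image[OF R'(2) vs _ m g] tree_rank_spread[OF R vs m g] vs R'(1) 1
      unfolding im by auto
  qed
  then show ?thesis unfolding eventually_sequentially by blast
qed

section \<open>Two diagonal constructions\<close>

text \<open>When \<open>m k\<close> is chosen, only finitely many conditions are active, those for \<open>I \<subseteq> {..<k}\<close> and \<open>s\<close>
  a set of numbers up to the previous value, and each of them holds for all large values. The index
  set \<open>I\<close> and its image \<open>s\<close> are kept as separate arguments so that a condition may also refer to the
  image of \<open>I\<close> under another sequence.\<close>
lemma diagonal_sequence:
  fixes Q :: "nat \<Rightarrow> nat set \<Rightarrow> nat set \<Rightarrow> nat \<Rightarrow> bool"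
  assumes M: "infinite M"
    and Q: "\<And>k I s. finite s \<Longrightarrow> \<forall>\<^sub>F v in sequentially. Q k I s v"
  obtains m where "strict_mono m" "range m \<subseteq> M" "\<And>k I. I \<subseteq> {..<k} \<Longrightarrow> Q k I (m ` I) (m k)"
proof -
  have ex: "\<exists>y\<in>M. b < y \<and> (\<forall>I\<in>Pow {..<k}. \<forall>s\<in>Pow {..b}. Q k I s y)" for k b
  proof -
    have "\<forall>\<^sub>F v in sequentially. \<forall>I\<in>Pow {..<k}. \<forall>s\<in>Pow {..b}. Q k I s v"
    proof (intro eventually_ball_finite ballI Q)
      show "finite s" if "s \<in> Pow {..b}" for s
        using that finite_subset[of s "{..b}"] by simp
    qed simp_all
    then obtain c where "\<And>v. v \<ge> c \<Longrightarrow> \<forall>I\<in>Pow {..<k}. \<forall>s\<in>Pow {..b}. Q k I s v"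
      unfolding eventually_sequentially by blast
    moreover obtain y where "y \<in> M" "y > max b c"
      using M unfolding infinite_nat_iff_unbounded by blast
    ultimately show ?thesis by (metis less_imp_le max_less_iff_conj)
  qed
  (* At k = 0 there is no previous value; the only condition is the one for empty sets. *)
  have "\<exists>m. \<forall>k. (m k \<in> M \<and> (k = 0 \<longrightarrow> Q 0 {} {} (m k))) \<and>
      (m k < m (Suc k) \<and> (\<forall>I\<in>Pow {..<Suc k}. \<forall>s\<in>Pow {..m k}. Q (Suc k) I s (m (Suc k))))"
  proof (rule dependent_nat_choice)
    show "\<exists>x. x \<in> M \<and> ((0::nat) = 0 \<longrightarrow> Q 0 {} {} x)"
      using ex[where k = 0] by blast
  next
    fix x n
    show "\<exists>y. (y \<in> M \<and> (Suc n = 0 \<longrightarrow> Q 0 {} {} y)) \<and>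
      x < y \<and> (\<forall>I\<in>Pow {..<Suc n}. \<forall>s\<in>Pow {..x}. Q (Suc n) I s y)"
      using ex[where k = "Suc n" and b = x] by blast
  qed
  then obtain m where m': "\<forall>k. (m k \<in> M \<and> (k = 0 \<longrightarrow> Q 0 {} {} (m k))) \<and>
      (m k < m (Suc k) \<and> (\<forall>I\<in>Pow {..<Suc k}. \<forall>s\<in>Pow {..m k}. Q (Suc k) I s (m (Suc k))))" ..
  have m: "m k \<in> M" "Q 0 {} {} (m 0)" "m k < m (Suc k)" for k
    using m' by auto
  have later: "Q (Suc k) I s (m (Suc k))" if "I \<subseteq> {..<Suc k}" "s \<subseteq> {..m k}" for k I s
    using m' that by (meson PowI)
  have sm: "strict_mono m" by (simp add: strict_mono_Suc_iff m(3))
  show thesis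
  proof
    show "range m \<subseteq> M" using m(1) by blast
    fix k and I :: "nat set" assume I: "I \<subseteq> {..<k}"
    show "Q k I (m ` I) (m k)"
    proof (cases k)
      case (Suc j)
      then have "m i \<le> m j" if "i \<in> I" for i
        using I that strict_mono_leD[OF sm, of i j] by auto
      then have "m ` I \<subseteq> {..m j}"
        by blast
      then show ?thesis
        using later I Suc by metis
    qed (use I m(2) in auto)
  qed (rule sm)
qed

lemma mem_thin_maximal:
  assumes "regular_thin F" and "s \<in> F"
  shows "s \<in> hat F" and "\<not> (\<exists>t\<in>hat F. s \<sqsubset> t)"
proof -
  show "s \<in> hat F"
    using assms by (auto simp: regular_thin_def hat_def init_seg_def)
  show "\<not> (\<exists>t\<in>hat F. s \<sqsubset> t)"
  proof
    assume "\<exists>t\<in>hat F. s \<sqsubset> t"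
    then obtain t u where tu: "u \<in> F" "t \<sqsubseteq> u" "s \<sqsubset> t"
      by (auto simp: hat_def)
    then have "s \<sqsubset> u"
      unfolding proper_init_seg_def init_seg_def by blast
    then show False
      using assms tu(1) by (auto simp: regular_thin_def thin_def)
  qed
qed

lemma maximal_mem_thin:
  assumes "regular_thin F" and "s \<in> hat F" and "\<not> (\<exists>t\<in>hat F. s \<sqsubset> t)"
  shows "s \<in> F"
proof -
  obtain u where u: "u \<in> F" "s \<sqsubseteq> u"
    using assms(2) by (auto simp: hat_def)
  then have "s = u"
    using assms(3) mem_thin_maximal(1)[OF assms(1) u(1)] by (auto simp: proper_init_seg_def)
  with u show ?thesis by simp
qed

lemma empty_mem_regular:
  assumes "regular R" shows "{} \<in> R"
  using assms unfolding regular_def hereditary_def by blast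

text \<open>A general infinite set need not have an initial segment in \<open>F\<close>, since a nonmaximal member of
  \<open>hat F\<close> is only prolonged by sufficiently large numbers. For a sequence growing fast enough, the
  next term always prolongs it, and an initial part that cannot be prolonged lies in \<open>F\<close>.\<close>
lemma very_large_sequence:
  assumes F: "regular_thin F" and M: "infinite M"
  obtains m :: "nat \<Rightarrow> nat" where "strict_mono m" "range m \<subseteq> M"
    "\<And>I. finite I \<Longrightarrow> m ` I \<in> hat F \<or> (\<exists>s\<in>F. s \<sqsubseteq> m ` I)"
proof -
  have R: "regular (hat F)" using F by (simp add: regular_thin_def)
  define Q :: "nat \<Rightarrow> nat set \<Rightarrow> nat set \<Rightarrow> nat \<Rightarrow> bool" where
    "Q = (\<lambda>k I s v. s \<in> hat F \<and> (\<exists>t\<in>hat F. s \<sqsubset> t) \<longrightarrow> insert v s \<in> hat F)"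
  have "\<forall>\<^sub>F v in sequentially. Q k I s v" for k I s
  proof (cases "s \<in> hat F \<and> (\<exists>t\<in>hat F. s \<sqsubset> t)")
    case True
    then obtain t where "s \<in> hat F" "t \<in> hat F" "s \<sqsubset> t" by blast
    from eventually_one_point_extension[OF R this] show ?thesis
      by eventually_elim (simp add: Q_def)
  next
    case False
    then show ?thesis by (intro always_eventually) (auto simp: Q_def)
  qed
  then obtain m where m: "strict_mono m" "range m \<subseteq> M"
      "\<And>k I. I \<subseteq> {..<k} \<Longrightarrow> Q k I (m ` I) (m k)"
    using diagonal_sequence[OF M, of Q] by metis
  have "m ` I \<in> hat F \<or> (\<exists>s\<in>F. s \<sqsubseteq> m ` I)" if "finite I" for I
    using that
  proof (induction I rule: finite_linorder_max_induct)
    case empty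
    then show ?case using empty_mem_regular[OF R] by simp
  next
    case (insert k I)
    have I: "I \<subseteq> {..<k}" using insert.hyps by auto
    have seg: "m ` I \<sqsubseteq> m ` insert k I"
      using image_insert_above[OF m(1) I] by (simp add: proper_init_seg_def)
    show ?case
    proof (cases "\<exists>s\<in>F. s \<sqsubseteq> m ` I")
      case True
      then show ?thesis using init_seg_trans[OF _ seg] by blast
    next
      case False
      then have h: "m ` I \<in> hat F" "m ` I \<notin> F"
        using insert.IH by (auto simp: init_seg_def)
      then have "\<exists>t\<in>hat F. m ` I \<sqsubset> t"
        using maximal_mem_thin[OF F] by blast
      then show ?thesis
        using m(3)[OF I] h(1) by (simp add: Q_def)
    qed
  qed
  with m that show thesis by blast
qed

text \<open>The comparison of orders at the empty set is turned into a copy, inside \<open>S\<close>, of the part of \<open>R\<close> that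
  lives on the range of \<open>m\<close>. Carrying the inequality of ranks along is what allows the
  induction to continue: it leaves room in \<open>S\<close> for every step that is possible in \<open>R\<close>.\<close>
lemma rank_dominating_sequence:
  fixes m :: "nat \<Rightarrow> nat"
  assumes R: "regular R" and S: "regular S"
    and le: "tree_rank R {} \<le> tree_rank S {}"
    and m: "strict_mono m" and M: "infinite M"
  obtains n :: "nat \<Rightarrow> nat" where "strict_mono n" "range n \<subseteq> M"
    "\<And>I. finite I \<Longrightarrow> m ` I \<in> R \<Longrightarrow> n ` I \<in> S \<and> tree_rank R (m ` I) \<le> tree_rank S (n ` I)"
proof -
  have R': "R \<subseteq> Fpow {1..}" "\<not> has_infinite_chain R" and S': "\<not> has_infinite_chain S"
    using R S regular_no_infinite_chain by (auto simp: regular_def)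
  define Q where "Q = (\<lambda>k I s v. I \<subseteq> {..<k} \<and> m ` insert k I \<in> R \<and> s \<in> S \<and>
      tree_rank R (m ` I) \<le> tree_rank S s \<longrightarrow>
      insert v s \<in> S \<and> tree_rank R (m ` insert k I) \<le> tree_rank S (insert v s))"
  have "\<forall>\<^sub>F v in sequentially. Q k I s v" for k I s
  proof (cases "I \<subseteq> {..<k} \<and> m ` insert k I \<in> R \<and> s \<in> S \<and> tree_rank R (m ` I) \<le> tree_rank S s")
    case True
    then have I: "I \<subseteq> {..<k}" and kI: "m ` insert k I \<in> R" and s: "s \<in> S"
      and rank: "tree_rank R (m ` I) \<le> tree_rank S s" by auto
    have "m ` I \<in> R"
      using regular_subset[OF R kI] by blast
    then have "tree_rank R (m ` insert k I) < tree_rank R (m ` I)"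
      using tree_rank_less[OF R'] kI image_insert_above[OF m I] by blast
    then have "tree_rank R (m ` insert k I) < tree_rank S s"
      using rank by simp
    then obtain t where t: "t \<in> S" "s \<sqsubset> t" "tree_rank R (m ` insert k I) \<le> tree_rank S t"
      by (rule less_tree_rankE[OF S' s])
    from eventually_one_point_extension[OF S s t(1,2)] show ?thesis
      by eventually_elim (use t(3) in \<open>auto simp: Q_def\<close>)
  next
    case False
    then show ?thesis by (intro always_eventually) (auto simp: Q_def)
  qed
  then obtain n where n: "strict_mono n" "range n \<subseteq> M"
      "\<And>k I. I \<subseteq> {..<k} \<Longrightarrow> Q k I (n ` I) (n k)"
    using diagonal_sequence[OF M, of Q] by metis
  have "m ` I \<in> R \<longrightarrow> n ` I \<in> S \<and> tree_rank R (m ` I) \<le> tree_rank S (n ` I)"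
    if "finite I" for I
    using that
  proof (induction I rule: finite_linorder_max_induct)
    case empty
    then show ?case using empty_mem_regular[OF S] le by simp
  next
    case (insert k I)
    have I: "I \<subseteq> {..<k}" using insert.hyps by auto
    show ?case
    proof
      assume kI: "m ` insert k I \<in> R"
      then have "m ` I \<in> R"
        using regular_subset[OF R kI] by blast
      then show "n ` insert k I \<in> S \<and> tree_rank R (m ` insert k I) \<le> tree_rank S (n ` insert k I)"
        using insert.IH n(3)[OF I] I kI by (simp add: Q_def)
    qed
  qed
  with n that show thesis by blast
qed

section \<open>Transfer of plegma families and spreading models\<close>

text \<open>Both plegma conditions compare elements at positions that exist in the sets involved. They
  survive shortening, which removes positions but changes no remaining element, and
  an increasing map, which preserves the comparisons.\<close>
lemma plegma_transfer:
  assumes t: "plegma k t" "\<And>j. j \<in> {1..k} \<Longrightarrow> t j \<subseteq> N"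
    and h: "strict_mono_on N h"
    and s: "\<And>j. j \<in> {1..k} \<Longrightarrow> s j \<sqsubseteq> h ` t j" "\<And>j. j \<in> {1..k} \<Longrightarrow> s j \<noteq> {}"
      "\<And>j. j \<in> {1..k} \<Longrightarrow> s j \<in> Fpow {1..}"
  shows "plegma k s"
    and "j \<in> {1..k} \<Longrightarrow> m \<in> {1..card (s j)} \<Longrightarrow> elt (s j) m = h (elt (t j) m)"
proof -
  have fin: "finite (t j)" if "j \<in> {1..k}" for j
    using t(1) that by (auto simp: plegma_def Fpow_def)
  have mono: "strict_mono_on (t j) h" if "j \<in> {1..k}" for j
    using h t(2)[OF that] by (auto simp: strict_mono_on_def)
  have card: "card (s j) \<le> card (t j)" if "j \<in> {1..k}" for j
  proof -
    have "card (s j) \<le> card (h ` t j)"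
      using s(1)[OF that] fin[OF that] by (intro card_mono) (auto simp: init_seg_def)
    then show ?thesis
      using card_image_le[OF fin[OF that], of h] by simp
  qed
  have elt: "elt (s j) m = h (elt (t j) m)" "elt (t j) m \<in> N"
    if "j \<in> {1..k}" "m \<in> {1..card (s j)}" for j m
  proof -
    have m: "m - 1 < card (s j)" "m - 1 < card (t j)"
      using that card[OF that(1)] by auto
    show "elt (s j) m = h (elt (t j) m)"
      unfolding elt_def
      using enumerate_init_seg[OF s(1)[OF that(1)] m(1)] enumerate_image[OF mono[OF that(1)]] m(2)
      by simp
    show "elt (t j) m \<in> N"
      unfolding elt_def
      using finite_enumerate_in_set[OF fin[OF that(1)] m(2)] t(2)[OF that(1)] by blast
  qed
  show "j \<in> {1..k} \<Longrightarrow> m \<in> {1..card (s j)} \<Longrightarrow> elt (s j) m = h (elt (t j) m)"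
    by (rule elt(1))
  show "plegma k s"
    unfolding plegma_def
  proof (intro conjI ballI impI)
    fix i j m assume ij: "i \<in> {1..k}" "j \<in> {1..k}" "i < j"
      and m: "m \<in> {1..min (card (s i)) (card (s j))}"
    have "m \<in> {1..min (card (t i)) (card (t j))}"
      using m card[OF ij(1)] card[OF ij(2)] by auto
    then have "elt (t i) m < elt (t j) m"
      using t(1) ij unfolding plegma_def by blast
    then show "elt (s i) m < elt (s j) m"
      using elt[OF ij(1), of m] elt[OF ij(2), of m] m strict_mono_onD[OF h] by auto
  next
    fix i j m assume ij: "i \<in> {1..k}" "j \<in> {1..k}"
      and m: "m \<in> {1..min (card (s i)) (card (s j) - 1)}"
    have "m \<in> {1..min (card (t i)) (card (t j) - 1)}"
      using m card[OF ij(1)] card[OF ij(2)] by auto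
    then have "elt (t i) m < elt (t j) (m + 1)"
      using t(1) ij unfolding plegma_def by blast
    moreover have "m \<in> {1..card (s i)}" "m + 1 \<in> {1..card (s j)}"
      using m by auto
    ultimately show "elt (s i) m < elt (s j) (m + 1)"
      using elt[OF ij(1), of m] elt[OF ij(2), of "m + 1"] strict_mono_onD[OF h] by auto
  qed (use s in auto)
qed

lemma enumerate_range:
  assumes "strict_mono (n :: nat \<Rightarrow> nat)"
  shows "enumerate (range n) i = n i"
proof -
  have "enumerate (UNIV :: nat set) i = i"
    by (induction i) (auto simp: enumerate_0 enumerate_Suc'' intro!: Least_equality)
  then show ?thesis
    using enumerate_image[of UNIV n i] assms by (simp add: strict_mono_on_def strict_mono_def)
qed

lemma enumerate_le_strict_mono:
  assumes "infinite M" "strict_mono m" "range m \<subseteq> M"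
  shows "enumerate M i \<le> m i"
proof (induction i)
  case 0
  then show ?case using assms(3) by (simp add: enumerate_0 Least_le image_subset_iff)
next
  case (Suc i)
  have "enumerate M i < m (Suc i)"
    using Suc strict_monoD[OF assms(2), of i "Suc i"] by simp
  then show ?case
    unfolding enumerate_Suc''[OF assms(1)]
    using assms(3) by (intro Least_le) auto
qed

lemma family_order_regular_thin:
  assumes "regular_thin F"
  shows "family_order F = tree_rank (hat F) {}"
  using regular_no_infinite_chain assms by (simp add: family_order_def regular_thin_def)

theorem lemma4p6:
  fixes F G :: "nat set set"
    and x :: "nat set \<Rightarrow> 'a::banach"
    and p :: "'e::real_vector \<Rightarrow> real"
    and e :: "nat \<Rightarrow> 'e"
  assumes "regular_thin F" and "regular_thin G"
    and "1 \<le> family_order F" and "family_order F \<le> family_order G"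
    and "seminorm p" and "hamel_basis e"
    and "admits_spreading_model F x p e"
  shows "\<exists>w :: nat set \<Rightarrow> 'a. w ` G \<subseteq> x ` F \<and> admits_spreading_model G w p e"
proof -
  note F = \<open>regular_thin F\<close> and G = \<open>regular_thin G\<close>
  have R: "regular (hat F)" and S: "regular (hat G)"
    using F G by (simp_all add: regular_thin_def)
  have R': "hat F \<subseteq> Fpow {1..}" "\<not> has_infinite_chain (hat F)"
    and S': "\<not> has_infinite_chain (hat G)"
    using R S regular_no_infinite_chain by (auto simp: regular_def)
  have le: "tree_rank (hat F) {} \<le> tree_rank (hat G) {}"
    using assms(4) family_order_regular_thin F G by simp
  (* Nonempty members are needed for plegma families; this is what o(F) \<ge> 1 provides. *)
  have "{} \<notin> F"
  proof
    assume "{} \<in> F"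
    then have "tree_rank (hat F) {} = 0"
      using tree_rank_maximal[OF R'(2)] mem_thin_maximal[OF F] by blast
    then show False
      using assms(3) family_order_regular_thin[OF F] zero_less_one_ordinal by auto
  qed
  obtain s0 where s0: "s0 \<in> F"
    using empty_mem_regular[OF R] by (auto simp: hat_def)
  obtain M where M: "M \<subseteq> {1..}" "infinite M" "generates_spreading_model F M x p e"
    using assms(7) by (auto simp: admits_spreading_model_def)
  obtain m :: "nat \<Rightarrow> nat" where m: "strict_mono m" "range m \<subseteq> M"
    "\<And>I. finite I \<Longrightarrow> m ` I \<in> hat F \<or> (\<exists>s\<in>F. s \<sqsubseteq> m ` I)"
    using very_large_sequence[OF F M(2)] by blast
  obtain n :: "nat \<Rightarrow> nat" where n: "strict_mono n" "range n \<subseteq> {1..}"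
    "\<And>I. finite I \<Longrightarrow> m ` I \<in> hat F \<Longrightarrow>
      n ` I \<in> hat G \<and> tree_rank (hat F) (m ` I) \<le> tree_rank (hat G) (n ` I)"
    using rank_dominating_sequence[OF R S le m(1) infinite_Ici[of 1]] by blast
  have injn: "inj n" by (rule strict_mono_imp_inj_on[OF n(1)])
  define h where "h = (\<lambda>i. m (inv n i))"
  have hn: "h (n i) = m i" for i
    using injn by (simp add: h_def)
  have hmono: "strict_mono_on (range n) h"
    using strict_mono_less[OF n(1)] strict_mono_less[OF m(1)]
    by (intro strict_mono_onI) (auto simp: hn)
  have ex: "\<exists>s\<in>F. s \<sqsubseteq> h ` t" if t: "t \<in> G" "t \<subseteq> range n" for t
  proof -
    have "finite t"
      using G t by (auto simp: regular_thin_def Fpow_def)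
    define I where "I = n -` t"
    have tI: "t = n ` I" and I: "finite I"
      using t(2) finite_vimageI[OF \<open>finite t\<close> injn] by (auto simp: I_def)
    have ht: "h ` t = m ` I"
      by (simp add: tI image_image hn)
    show ?thesis
    proof (cases "m ` I \<in> hat F")
      case True
      have "tree_rank (hat G) t = 0"
        using tree_rank_maximal[OF S'] mem_thin_maximal[OF G t(1)] by blast
      then have "tree_rank (hat F) (m ` I) \<le> 0"
        using n(3)[OF I True] tI by simp
      then have "\<not> (\<exists>s\<in>hat F. m ` I \<sqsubset> s)"
        using tree_rank_less[OF R' True] ordinal_zero_le by (meson leD le_less_trans)
      then have "m ` I \<in> F"
        by (rule maximal_mem_thin[OF F True])
      then show ?thesis
        using ht by (auto simp: init_seg_def)
    next
      case False
      then show ?thesis using m(3)[OF I] ht by simp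
    qed
  qed
  (* Off the range of n the value only has to lie in F, so that w takes its values among the given vectors. *)
  define \<phi> where "\<phi> = (\<lambda>t. if t \<subseteq> range n then SOME s. s \<in> F \<and> s \<sqsubseteq> h ` t else s0)"
  have \<phi>: "\<phi> t \<in> F" "\<phi> t \<sqsubseteq> h ` t" if "t \<in> G" "t \<subseteq> range n" for t
    using someI_ex[of "\<lambda>s. s \<in> F \<and> s \<sqsubseteq> h ` t"] ex[OF that] that(2) by (auto simp: \<phi>_def)
  have \<phi>F: "\<phi> t \<in> F" if "t \<in> G" for t
    using \<phi>(1)[OF that] s0 by (cases "t \<subseteq> range n") (auto simp: \<phi>_def)
  obtain \<delta> :: "nat \<Rightarrow> real" where \<delta>: "\<forall>n\<ge>1. 0 < \<delta> n" "\<delta> \<longlonglongrightarrow> 0"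
    and gen: "\<And>l k a s. l \<ge> 1 \<Longrightarrow> k \<in> {1..l} \<Longrightarrow> (\<forall>j\<in>{1..k}. a j \<in> {-1..1}) \<Longrightarrow>
      s \<in> Plm k (F \<restriction> M) \<Longrightarrow> elt M l \<le> elt (s 1) 1 \<Longrightarrow>
      \<bar>norm (\<Sum>j=1..k. a j *\<^sub>R x (s j)) - p (\<Sum>j=1..k. a j *\<^sub>R e j)\<bar> \<le> \<delta> l"
    using M(3) unfolding generates_spreading_model_def by blast
  have "generates_spreading_model G (range n) (x \<circ> \<phi>) p e"
    unfolding generates_spreading_model_def
  proof (intro exI[of _ \<delta>] conjI allI impI ballI \<delta>(2))
    show "0 < \<delta> i" if "1 \<le> i" for i
      using \<delta>(1) that by blast
  next
    fix l k :: nat and a :: "nat \<Rightarrow> real" and t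
    assume l: "1 \<le> l" and k: "k \<in> {1..l}" and a: "\<forall>j\<in>{1..k}. a j \<in> {-1..1}"
      and t: "t \<in> Plm k (G \<restriction> range n)" and tl: "elt (range n) l \<le> elt (t 1) 1"
    have tG: "t j \<in> G" "t j \<subseteq> range n" if "j \<in> {1..k}" for j
      using t that by (auto simp: Plm_def restr_def Fpow_def)
    have tp: "plegma k t"
      using t by (simp add: Plm_def)
    define s where "s = restrict (\<lambda>j. \<phi> (t j)) {1..k}"
    have s: "s j \<in> F" "s j \<sqsubseteq> h ` t j" if "j \<in> {1..k}" for j
      using \<phi>[OF tG[OF that]] that by (simp_all add: s_def)
    have s': "s j \<noteq> {}" "s j \<in> Fpow {1..}" if "j \<in> {1..k}" for j
      using s(1)[OF that] \<open>{} \<notin> F\<close> F by (auto simp: regular_thin_def)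
    have sM: "s j \<subseteq> M" if "j \<in> {1..k}" for j
    proof -
      have "h ` t j \<subseteq> range m"
        using tG(2)[OF that] by (auto simp: h_def)
      then show ?thesis
        using s(2)[OF that] m(2) unfolding init_seg_def by blast
    qed
    note pl = plegma_transfer[OF tp tG(2) hmono s(2) s']
    have "s j \<in> F \<restriction> M" if "j \<in> {1..k}" for j
      using s(1)[OF that] s'(2)[OF that] sM[OF that] by (simp add: restr_def Fpow_def)
    then have "s \<in> {1..k} \<rightarrow>\<^sub>E F \<restriction> M"
      by (intro PiE_I) (auto simp: s_def)
    then have sP: "s \<in> Plm k (F \<restriction> M)"
      using pl(1) by (simp add: Plm_def)
    have one: "1 \<in> {1..k}" using k by auto
    have "card (s 1) \<noteq> 0"
      using s'[OF one] by (auto simp: Fpow_def)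
    then have e1: "elt (s 1) 1 = h (elt (t 1) 1)"
      by (intro pl(2) one) auto
    have "elt (t 1) 1 \<in> t 1"
    proof -
      have "finite (t 1)" "t 1 \<noteq> {}"
        using tp one by (auto simp: plegma_def Fpow_def)
      then show ?thesis
        unfolding elt_def by (intro finite_enumerate_in_set) (auto simp: card_gt_0_iff)
    qed
    then obtain i where i: "elt (t 1) 1 = n i"
      using tG(2)[OF one] by auto
    (* The smallest element of t 1 is at least the l-th term of n (index l - 1), so its image is at
       least the l-th term of m, which in turn is at least the l-th element of M. *)
    have "n (l - 1) \<le> n i"
      using tl i enumerate_range[OF n(1)] by (simp add: elt_def)
    then have "m (l - 1) \<le> m i"
      using strict_mono_less_eq[OF n(1)] strict_mono_less_eq[OF m(1)] by simp
    then have "elt M l \<le> elt (s 1) 1"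
      using enumerate_le_strict_mono[OF M(2) m(1,2), of "l - 1"] e1 i hn by (simp add: elt_def)
    then have "\<bar>norm (\<Sum>j=1..k. a j *\<^sub>R x (s j)) - p (\<Sum>j=1..k. a j *\<^sub>R e j)\<bar> \<le> \<delta> l"
      by (rule gen[OF l k a sP])
    moreover have "(\<Sum>j=1..k. a j *\<^sub>R x (s j)) = (\<Sum>j=1..k. a j *\<^sub>R (x \<circ> \<phi>) (t j))"
      by (intro sum.cong) (auto simp: s_def)
    ultimately show "\<bar>norm (\<Sum>j=1..k. a j *\<^sub>R (x \<circ> \<phi>) (t j)) - p (\<Sum>j=1..k. a j *\<^sub>R e j)\<bar> \<le> \<delta> l"
      by simp
  qed
  moreover have "infinite (range n)"
    using injn by (simp add: finite_image_iff)
  ultimately have "admits_spreading_model G (x \<circ> \<phi>) p e"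
    using n(2) unfolding admits_spreading_model_def by blast
  moreover have "(x \<circ> \<phi>) ` G \<subseteq> x ` F"
    using \<phi>F by auto
  ultimately show ?thesis by blast
qed

end
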